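(* Let $A=[a_1\,\cdots\,a_n]\in\mathbb{Z}^{d\times n}$ be a matrix whose columns span $\mathbb{Z}^d$ as a lattice and for which there is a vector $\xi\in\mathbb{N}^d$ with $\xi A=(1,\dots,1)$. Let $F(\beta;x)$ be an $A$-hypergeometric function for which there exists a transformation, valid for generic parameters $\beta$, $$F(\beta;x)=K(\beta)\,F(T\beta;\,xP),$$ where $T$ is a $d\times d$ matrix, $P$ is an $n\times n$ permutation matrix and $K(\beta)$ is constant with respect to $x$. Then $TA=AP$. That is, $P$ encodes a polytope symmetry of $A$.
   Context: $\mathbb{N}=\{0,1,2,\dots\}$. For $\beta\in\mathbb{C}^d$, the $A$-hypergeometric system $H_A(\beta)$ is the system of linear partial differential equations for a function $F=F(x_1,\dots,x_n)$, with $\partial_j=\partial/\partial x_j$: $$\partial^uF-\partial^vF=0\quad\text{for all }u,v\in\mathbb{N}^n\text{ with }Au=Av,\qquad \sum_{j=1}^n a_{ij}x_j\partial_jF=\beta_iF\quad(i=1,\dots,d).$$ An $A$-hypergeometric function $F(\beta;x)$ is a (nonzero) function of $x=(x_1,\dots,x_n)$, depending on the parameter $\beta\in\mathbb{C}^d$, that solves $H_A(\beta)$. Here $x$ is a row vector, $\beta$ is a column vector, and $xP$ and $T\beta$ denote standard matrix multiplication. A pair $(T,P)$ with $P$ a permutation matrix and $TA=AP$ is said to encode a polytope symmetry: the linear map $T$ permutes the columns of $A$, and hence is a symmetry of the polytope given by their convex hull.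
   Formalization: "TA = AP" is false as stated (A = I_3, F = x_1^{β_1}x_2^{β_2}x_3^{β_3}, P a 3-cycle, T = P^T); the conclusion proved is TA = AP^T = AP^{-1}, T is invertible and T^{-1}A = AP, so P encodes the polytope symmetry given by T^{-1}. *)

theory Defs
  imports "HOL-Analysis.Analysis"
begin

definition partial_deriv :: "'n \<Rightarrow> (complex ^ 'n::finite \<Rightarrow> complex) \<Rightarrow> complex ^ 'n \<Rightarrow> complex" where
  "partial_deriv j f x = deriv (\<lambda>t. f (x + axis j t)) 0"

text \<open>The operator with multi-index \<open>u\<close>, composed in the order of the variables. The linear order
  on the index type serves only to fix this order; on holomorphic functions it is immaterial.\<close>

definition multi_deriv ::
    "nat ^ 'n::{finite,linorder} \<Rightarrow> (complex ^ 'n::_ \<Rightarrow> complex) \<Rightarrow> complex ^ 'n::_ \<Rightarrow> complex" where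
  "multi_deriv u f = foldr (\<lambda>j. partial_deriv j ^^ (u $ j)) (sorted_list_of_set UNIV) f"

text \<open>Holomorphy in several variables: the Frechet derivative exists and is complex linear.\<close>

definition holomorphic_several :: "(complex ^ 'n::finite \<Rightarrow> complex) \<Rightarrow> (complex ^ 'n) set \<Rightarrow> bool" where
  "holomorphic_several f U \<longleftrightarrow>
     (\<forall>x\<in>U. \<exists>c :: complex ^ 'n. (f has_derivative (\<lambda>h. \<Sum>j\<in>UNIV. c $ j * h $ j)) (at x))"

text \<open>\<open>f\<close> solves \<open>H\<^sub>A(\<beta>)\<close> on \<open>U\<close>. The rows of \<open>A\<close> are indexed by \<open>'d\<close>, its columns by \<open>'n\<close>.\<close>

definition solves_H ::
    "int ^ 'n::{finite,linorder} ^ 'd::finite \<Rightarrow> complex ^ 'd \<Rightarrow> (complex ^ 'n::_) set \<Rightarrow>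
      (complex ^ 'n::_ \<Rightarrow> complex) \<Rightarrow> bool" where
  "solves_H A \<beta> U f \<longleftrightarrow>
     (\<forall>u v :: nat ^ 'n::_. A *v (\<chi> j. int (u $ j)) = A *v (\<chi> j. int (v $ j)) \<longrightarrow>
        (\<forall>x\<in>U. multi_deriv u f x - multi_deriv v f x = 0)) \<and>
     (\<forall>i. \<forall>x\<in>U. (\<Sum>j\<in>UNIV. of_int (A $ i $ j) * x $ j * partial_deriv j f x) = \<beta> $ i * f x)"

text \<open>Hypergeometric functions are multivalued in \<open>x\<close>; \<open>f\<close> is a branch of such a function on a
  domain \<open>U\<close>, that is, on a connected open set.\<close>

definition A_hypergeometric ::
    "int ^ 'n::{finite,linorder} ^ 'd::finite \<Rightarrow> complex ^ 'd \<Rightarrow> (complex ^ 'n::_) set \<Rightarrow>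
      (complex ^ 'n::_ \<Rightarrow> complex) \<Rightarrow> bool" where
  "A_hypergeometric A \<beta> U f \<longleftrightarrow>
     open U \<and> connected U \<and> holomorphic_several f U \<and> (\<exists>x\<in>U. f x \<noteq> 0) \<and> solves_H A \<beta> U f"

inductive_set polynomial_functions :: "(complex ^ 'd::finite \<Rightarrow> complex) set" where
  const: "(\<lambda>_. c) \<in> polynomial_functions"
| coord: "(\<lambda>\<beta>. \<beta> $ i) \<in> polynomial_functions"
| add: "p \<in> polynomial_functions \<Longrightarrow> q \<in> polynomial_functions \<Longrightarrow> (\<lambda>\<beta>. p \<beta> + q \<beta>) \<in> polynomial_functions"
| mult: "p \<in> polynomial_functions \<Longrightarrow> q \<in> polynomial_functions \<Longrightarrow> (\<lambda>\<beta>. p \<beta> * q \<beta>) \<in> polynomial_functions"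

text \<open>Generic parameters: those outside countably many proper algebraic subvarieties. Countably
  many are allowed, and not only finitely many, because the usual exceptional parameters
  (resonant ones, for instance) form infinite families of hyperplanes.\<close>

definition generic :: "(complex ^ 'd::finite \<Rightarrow> bool) \<Rightarrow> bool" where
  "generic Q \<longleftrightarrow>
     (\<exists>S \<subseteq> polynomial_functions. countable S \<and> (\<lambda>_. 0) \<notin> S \<and>
        (\<forall>\<beta>. (\<forall>p\<in>S. p \<beta> \<noteq> 0) \<longrightarrow> Q \<beta>))"

text \<open>The transformation \<open>F(\<beta>; x) = K(\<beta>) F(T \<beta>; x P)\<close> for the parameter \<open>\<beta>\<close>. The branches
  \<open>F \<beta>\<close> on \<open>D \<beta>\<close> and \<open>F (T \<beta>)\<close> on \<open>D (T \<beta>)\<close> are only required to be related by it on some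
  nonempty open set; elsewhere it then holds by analytic continuation.\<close>

definition hypergeometric_transformation ::
    "(complex ^ 'd::finite \<Rightarrow> (complex ^ 'n::finite) set) \<Rightarrow> (complex ^ 'd \<Rightarrow> complex ^ 'n \<Rightarrow> complex) \<Rightarrow>
      (complex ^ 'd \<Rightarrow> complex) \<Rightarrow> complex ^ 'd ^ 'd \<Rightarrow> complex ^ 'n ^ 'n \<Rightarrow> complex ^ 'd \<Rightarrow> bool" where
  "hypergeometric_transformation D F K T P \<beta> \<longleftrightarrow>
     (\<exists>V. open V \<and> V \<noteq> {} \<and>
        (\<forall>x\<in>V. x \<in> D \<beta> \<and> x v* P \<in> D (T *v \<beta>) \<and> F \<beta> x = K \<beta> * F (T *v \<beta>) (x v* P)))"

definition permutation_matrix :: "complex ^ 'n::finite ^ 'n \<Rightarrow> bool" where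
  "permutation_matrix P \<longleftrightarrow> (\<exists>\<sigma>. \<sigma> permutes UNIV \<and> P = (\<chi> i j. if i = \<sigma> j then 1 else 0))"

text \<open>Pitfall: a transformation \<open>F(\<beta>; x) = K(\<beta>) F(T \<beta>; x P)\<close>, with \<open>x\<close> a row vector, corresponds to
  \<open>T A = A P\<^sup>T = A P\<^sup>-\<^sup>1\<close>, and not to \<open>T A = A P\<close>. For example, if \<open>A\<close> is the identity matrix and
  \<open>F(\<beta>; x) = \<Prod>\<^sub>i x\<^sub>i powr \<beta>\<^sub>i\<close>, then \<open>F(\<beta>; x) = F(P\<^sup>T \<beta>; x P)\<close> for every permutation matrix \<open>P\<close>.
  So the symmetry that \<open>P\<close> itself encodes is the one given by the inverse of \<open>T\<close>.\<close>

definition encodes_polytope_symmetry ::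
    "int ^ 'n::finite ^ 'd::finite \<Rightarrow> complex ^ 'd ^ 'd \<Rightarrow> complex ^ 'n ^ 'n \<Rightarrow> bool" where
  "encodes_polytope_symmetry A T P \<longleftrightarrow>
     permutation_matrix P \<and> T ** map_matrix of_int A = map_matrix of_int A ** P"

end

(*
  Let f = F(beta) and let b range over the rows of A P^T. Applying the chain rule to the
  transformation, f satisfies, besides the Euler equations of H_A(beta), those with weights b and
  degrees T beta. If some b were not in the rational row space of A, there would be an integer vector
  u - v in the kernel of A with b u <> b v; the toric equation d^u f = d^v f equates functions of
  different degrees, so d^u f = 0. For generic beta this is impossible: if any derivative of f
  vanished, then some nonzero derivative of f would be independent of some of the variables, and the
  toric and Euler equations would force an integral linear form in beta to take an integer value.
  Hence A P^T = M A for a matrix M, and comparing degrees gives T beta = M beta for generic beta,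
  so T = M.
*)
theory Submission
  imports Defs "HOL-Complex_Analysis.Conformal_Mappings"
begin

section \<open>Integer vectors and toric ideals\<close>

text \<open>Each \<open>F \<beta>\<close> is a single branch, and the transformation is known only
  on some open set, so all information is drawn from the Euler and toric equations of one function
  near one point. The identity theorem guarantees that this function does not vanish identically
  there. The toric equations involve derivatives of every order, hence the calculus of commuting
  partial derivatives. The transpose arises from (xP)_j = x_(\<sigma> j): in the coordinates x, the
  weight of the k-th variable in the i-th Euler operator becomes the entry of A at (i, \<sigma>^-1
  k), which is the entry of A P^T at (i, k). The excluded parameters form countably many integral
  hyperplanes besides those of the hypothesis, so that a good parameter exists by Baire's theorem.
  The relation that yields M mentions only A and \<sigma>, so a single good parameter suffices to
  find it.\<close>

lemma not_in_span_separated: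
  fixes S :: "('a::field ^ 'n::finite) set"
  assumes a: "a \<notin> vec.span S"
  shows "\<exists>l :: 'a ^ 'n. (\<forall>s\<in>S. (\<Sum>i\<in>UNIV. l $ i * s $ i) = 0) \<and> (\<Sum>i\<in>UNIV. l $ i * a $ i) \<noteq> 0"
proof -
  obtain B where B: "B \<subseteq> S" "vec.independent B" "S \<subseteq> vec.span B"
    using vec.maximal_independent_subset by blast
  have "vec.span B = vec.span S"
    using B by (metis vec.span_mono vec.span_span subset_antisym)
  then have "a \<notin> vec.span B" using a by simp
  then have ind: "vec.independent (insert a B)"
    using B vec.independent_insert[of a B] by (cases "a \<in> B") (simp_all add: insert_absorb)
  \<comment> \<open>The functional is one coordinate of a linear self-map that kills
    \<open>B\<close> but not \<open>a\<close>; \<open>undefined\<close> is an arbitrary fixed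
    index.\<close>
  define b where "b = (axis undefined 1 :: 'a ^ 'n)"
  obtain g where g: "Vector_Spaces.linear (*s) (*s) g" "\<forall>x\<in>insert a B. g x = (if x = a then b else 0)"
    using vec.linear_independent_extend[OF ind, of "\<lambda>x. if x = a then b else 0"] by auto
  have ga: "g a = b" using g by auto
  have gB: "g x = 0" if "x \<in> B" for x
    using g that \<open>a \<notin> vec.span B\<close> vec.span_base by auto
  have gS: "g x = 0" if "x \<in> S" for x
  proof -
    have "x \<in> vec.span B" using B that by auto
    then show ?thesis
      using vec.linear_eq_0_on_span[OF g(1) gB] by blast
  qed
  let ?l = "matrix g $ undefined"
  have l: "(\<Sum>i\<in>UNIV. ?l $ i * x $ i) = g x $ undefined" for x
    unfolding matrix_works[OF g(1), of x, symmetric] matrix_vector_mult_def by simp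
  show "\<exists>l :: 'a ^ 'n. (\<forall>s\<in>S. (\<Sum>i\<in>UNIV. l $ i * s $ i) = 0) \<and> (\<Sum>i\<in>UNIV. l $ i * a $ i) \<noteq> 0"
    by (rule exI[of _ ?l]) (simp add: l ga gS b_def)
qed

text \<open>Coefficients are indexed by \<open>I\<close> and not by the vectors, so repetitions in
  \<open>s\<close> do no harm. The combinations form a subspace that contains every
  \<open>s k\<close>, hence the span.\<close>

lemma in_span_image_finite:
  fixes s :: "'k \<Rightarrow> 'a::field ^ 'n::finite"
  assumes "finite I" "a \<in> vec.span (s ` I)"
  shows "\<exists>r. a = (\<Sum>k\<in>I. r k *s s k)"
proof -
  let ?X = "range (\<lambda>r. \<Sum>k\<in>I. r k *s s k)"
  have "vec.subspace ?X"
  proof (rule vec.subspaceI)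
    show "0 \<in> ?X" by (rule range_eqI[of _ _ "\<lambda>_. 0"]) simp
  next
    fix x y assume "x \<in> ?X" "y \<in> ?X"
    then obtain r r' where "x = (\<Sum>k\<in>I. r k *s s k)" "y = (\<Sum>k\<in>I. r' k *s s k)" by auto
    then show "x + y \<in> ?X"
      by (intro range_eqI[of _ _ "\<lambda>k. r k + r' k"]) (simp add: sum.distrib vec.scale_left_distrib)
  next
    fix c x assume "x \<in> ?X"
    then obtain r where "x = (\<Sum>k\<in>I. r k *s s k)" by auto
    then show "c *s x \<in> ?X"
      by (intro range_eqI[of _ _ "\<lambda>k. c * r k"]) (simp add: vec.scale_sum_right)
  qed
  moreover have "s ` I \<subseteq> ?X"
  proof
    fix x assume "x \<in> s ` I"
    then obtain k where k: "k \<in> I" "x = s k" by auto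
    have "(\<Sum>j\<in>I. (if j = k then 1 else 0) *s s j) = (\<Sum>j\<in>I. if j = k then s j else 0)"
      by (rule sum.cong) auto
    also have "\<dots> = x" using k assms(1) by simp
    finally show "x \<in> ?X"
      by (intro range_eqI[of _ _ "\<lambda>j. if j = k then 1 else 0"]) (rule sym)
  qed
  ultimately have "vec.span (s ` I) \<subseteq> ?X" by (rule vec.span_minimal[rotated])
  then show ?thesis using assms(2) by auto
qed

lemma common_denominator:
  fixes r :: "'k \<Rightarrow> rat"
  assumes "finite I"
  shows "\<exists>N::int. N > 0 \<and> (\<exists>m. \<forall>k\<in>I. of_int N * r k = of_int (m k))"
  using assms
proof (induction I)
  case empty
  show ?case by (rule exI[of _ 1]) simp
next
  case (insert x I)
  then obtain N m where N: "N > 0" and m: "\<And>k. k \<in> I \<Longrightarrow> of_int N * r k = of_int (m k)" by blast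
  obtain p q where pq: "r x = of_int p / of_int q" "q > 0"
    by (metis quotient_of_denom_pos' quotient_of_div surjective_pairing)
  show ?case
  proof (intro exI[of _ "N * q"] exI[of _ "\<lambda>k. if k = x then N * p else q * m k"] conjI ballI)
    show "N * q > 0" using N pq by simp
    fix k assume "k \<in> insert x I"
    then show "of_int (N * q) * r k = of_int (if k = x then N * p else q * m k)"
      using pq m[of k] by (auto simp: mult_ac)
  qed
qed

text \<open>The Fredholm alternative over the rationals with denominators cleared. The factor
  \<open>N\<close> allows for an \<open>a\<close> in the rational span but outside the lattice
  generated by the \<open>s k\<close>.\<close>

lemma int_span_or_separated:
  fixes s :: "'k \<Rightarrow> int ^ 'n::finite" and a :: "int ^ 'n"
  assumes "finite I"
  shows "(\<exists>N m. N > 0 \<and> (\<forall>i. N * a $ i = (\<Sum>k\<in>I. m k * s k $ i))) \<or>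
    (\<exists>l :: int ^ 'n. (\<forall>k\<in>I. (\<Sum>i\<in>UNIV. l $ i * s k $ i) = 0) \<and> (\<Sum>i\<in>UNIV. l $ i * a $ i) \<noteq> 0)"
proof -
  define Q :: "int ^ 'n \<Rightarrow> rat ^ 'n" where "Q v = (\<chi> i. of_int (v $ i))" for v
  consider "Q a \<in> vec.span ((\<lambda>k. Q (s k)) ` I)"
    | l :: "rat ^ 'n" where "\<forall>v\<in>(\<lambda>k. Q (s k)) ` I. (\<Sum>i\<in>UNIV. l $ i * v $ i) = 0" "(\<Sum>i\<in>UNIV. l $ i * Q a $ i) \<noteq> 0"
    using not_in_span_separated[of "Q a" "(\<lambda>k. Q (s k)) ` I"] by blast
  then show ?thesis
  proof cases
    case 1
    then obtain r where r: "Q a = (\<Sum>k\<in>I. r k *s Q (s k))"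
      using in_span_image_finite[OF assms] by blast
    obtain N m where N: "N > 0" and m: "\<And>k. k \<in> I \<Longrightarrow> of_int N * r k = of_int (m k)"
      using common_denominator[OF assms] by metis
    have "N * a $ i = (\<Sum>k\<in>I. m k * s k $ i)" for i
    proof -
      have "(of_int (N * a $ i) :: rat) = of_int N * Q a $ i" by (simp add: Q_def)
      also have "\<dots> = (\<Sum>k\<in>I. (of_int N * r k) * of_int (s k $ i))"
        by (simp add: r sum_distrib_left mult.assoc) (simp add: Q_def)
      also have "\<dots> = of_int (\<Sum>k\<in>I. m k * s k $ i)" by (simp add: m)
      finally show ?thesis by (simp only: of_int_eq_iff)
    qed
    then show ?thesis using N by blast
  next
    case 2
    obtain N m where N: "N > 0" and m: "\<And>i. of_int N * l $ i = of_int (m i)"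
      using common_denominator[of "UNIV :: 'n set" "\<lambda>i. l $ i"] by auto
    have *: "(of_int (\<Sum>i\<in>UNIV. m i * v $ i) :: rat) = of_int N * (\<Sum>i\<in>UNIV. l $ i * Q v $ i)" for v
      by (simp add: Q_def sum_distrib_left m[symmetric] mult_ac)
    have "(\<Sum>i\<in>UNIV. m i * s k $ i) = 0" if "k \<in> I" for k
      using *[of "s k"] 2 that by (simp del: of_int_sum)
    moreover have "(\<Sum>i\<in>UNIV. m i * a $ i) \<noteq> 0"
      using *[of a] 2 N by (auto simp del: of_int_sum)
    ultimately show ?thesis by (intro disjI2 exI[of _ "\<chi> i. m i"]) auto
  qed
qed

section \<open>Multi-indices and sets of vanishing derivatives\<close>

lemma nat_vec_split:
  fixes w :: "nat ^ 'n::finite"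
  assumes "w $ j > 0"
  obtains w' where "w = w' + axis j 1"
proof
  show "w = (\<chi> k. if k = j then w $ k - 1 else w $ k) + axis j 1"
    using assms by (auto simp: vec_eq_iff axis_def)
qed

lemma nat_vec_induct [case_names zero add_axis]:
  fixes P :: "nat ^ 'n::finite \<Rightarrow> bool"
  assumes "P 0" "\<And>w j. P w \<Longrightarrow> P (w + axis j 1)"
  shows "P w"
proof (induction "\<Sum>k\<in>UNIV. w $ k" arbitrary: w)
  case 0
  then have "w = 0" by (simp add: vec_eq_iff)
  then show ?case using assms(1) by simp
next
  case (Suc n)
  then obtain j where "w $ j > 0"
    by (metis (no_types, lifting) gr0I nat.distinct(1) sum.neutral)
  then obtain w' where w: "w = w' + axis j 1" by (rule nat_vec_split)
  then have "(\<Sum>k\<in>UNIV. w $ k) = (\<Sum>k\<in>UNIV. w' $ k) + 1"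
    by (simp add: sum.distrib axis_def)
  then have "P w'" using Suc by simp
  then show ?case using w assms(2) by simp
qed

text \<open>Below, \<open>Z\<close> is the set of multi-indices of the vanishing derivatives of a solution \<open>f\<close>. Choose
  \<open>w \<notin> Z\<close> with the set \<open>J\<close> of variables on which the \<open>w\<close>-th derivative \<open>g\<close> of \<open>f\<close> does not depend as
  large as possible; then no derivative of \<open>g\<close> in the other variables vanishes. If column \<open>j \<in> J\<close> of
  \<open>A\<close> is a rational combination of the columns outside \<open>J\<close>, the toric relation equates a derivative of
  \<open>g\<close> involving \<open>j\<close> with one in the variables outside \<open>J\<close>. Otherwise some \<open>l \<noteq> 0\<close> kills all columns
  outside \<open>J\<close>, so that the Euler operator of \<open>l\<close> annihilates \<open>g\<close>, which \<open>euler\<close> excludes.\<close>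

lemma toric_ideal_empty:
  fixes A :: "int ^ 'n::finite ^ 'd::finite" and Z :: "(nat ^ 'n) set"
  assumes zero: "0 \<notin> Z"
    and ideal: "\<And>w j. w \<in> Z \<Longrightarrow> w + axis j 1 \<in> Z"
    and toric: "\<And>u v. A *v (\<chi> j. int (u $ j)) = A *v (\<chi> j. int (v $ j)) \<Longrightarrow> u \<in> Z \<Longrightarrow> v \<in> Z"
    and euler: "\<And>w l :: int ^ 'd. w \<notin> Z \<Longrightarrow> l \<noteq> 0 \<Longrightarrow>
      \<exists>k. (\<Sum>i\<in>UNIV. l $ i * A $ i $ k) \<noteq> 0 \<and> w + axis k 1 \<notin> Z"
  shows "Z = {}"
proof (rule ccontr)
  assume "Z \<noteq> {}"
  then obtain z where z: "z \<in> Z" by auto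
  have ideal': "w + v \<in> Z" if "w \<in> Z" for w v
    using that by (induction v rule: nat_vec_induct) (simp_all add: add.assoc[symmetric] ideal del: One_nat_def)
  define J where "J w = {j. w + axis j 1 \<in> Z}" for w
  define w where "w = (ARG_MAX (\<lambda>w. card (J w)) w. w \<notin> Z)"
  have "w \<notin> Z \<and> (\<forall>y. y \<notin> Z \<longrightarrow> card (J y) \<le> card (J w))"
    unfolding w_def
    by (rule arg_max_nat_lemma[of _ 0 _ "Suc CARD('n)"]) (simp_all add: zero less_Suc_eq_le card_mono)
  then have w: "w \<notin> Z" and max: "\<And>y. y \<notin> Z \<Longrightarrow> card (J y) \<le> card (J w)" by auto
  have Jmono: "J w \<subseteq> J (w + v)" for v
  proof
    fix i assume "i \<in> J w"
    then have "w + axis i 1 + v \<in> Z" unfolding J_def using ideal' by blast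
    then show "i \<in> J (w + v)" unfolding J_def by (simp add: add_ac del: One_nat_def)
  qed
  have off: "w + v \<notin> Z" if "\<And>j. j \<in> J w \<Longrightarrow> v $ j = 0" for v
    using that
  proof (induction v rule: nat_vec_induct)
    case zero
    then show ?case using w by simp
  next
    case (add_axis v j)
    have v: "v $ i = 0" if "i \<in> J w" for i using add_axis(2)[OF that] by simp
    have "j \<notin> J w" using add_axis(2)[of j] by (auto simp: axis_def)
    have n: "w + v \<notin> Z" using add_axis(1) v by simp
    \<comment> \<open>\<open>J (w + v)\<close> contains \<open>J w\<close> and, by the choice of
      \<open>w\<close>, is not larger. So no new variable becomes missing on the way.\<close>
    have "J (w + v) = J w"
      using card_seteq[OF _ Jmono max[OF n]] by simp
    then have "j \<notin> J (w + v)" using \<open>j \<notin> J w\<close> by simp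
    then show ?case unfolding J_def by (simp add: add.assoc del: One_nat_def)
  qed
  show False
  proof (cases "J w = {}")
    case True
    \<comment> \<open>With \<open>J w\<close> empty, \<open>off\<close> covers every multi-index,
      but \<open>w + z\<close> is in \<open>Z\<close> because \<open>z\<close> is.\<close>
    then show False using off[of z] ideal'[OF z, of w] by (simp add: add_ac)
  next
    case False
    then obtain j where j: "j \<in> J w" by auto
    have sep: False if "\<forall>k\<in>- J w. (\<Sum>i\<in>UNIV. l $ i * column k A $ i) = 0"
      "(\<Sum>i\<in>UNIV. l $ i * column j A $ i) \<noteq> 0" for l
    proof -
      have "l \<noteq> 0" using that(2) by auto
      then obtain k where "(\<Sum>i\<in>UNIV. l $ i * A $ i $ k) \<noteq> 0" "k \<notin> J w"
        using euler[OF w, of l] by (auto simp: J_def)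
      then show False using that(1) by (auto simp: column_def)
    qed
    then obtain N m where N: "N > 0"
      and m: "\<And>i. N * column j A $ i = (\<Sum>k\<in>- J w. m k * column k A $ i)"
      using int_span_or_separated[of "- J w" "column j A" "\<lambda>k. column k A"] by auto
    \<comment> \<open>Moving the terms with negative \<open>m k\<close> to the side of
      \<open>N\<close> turns the integral relation between columns into \<open>A u = A v\<close>
      with natural exponents; \<open>nat\<close> cuts off the wrong sign.\<close>
    define u :: "nat ^ 'n" where "u = (\<chi> i. if i = j then nat N else if i \<in> J w then 0 else nat (- m i))"
    define v :: "nat ^ 'n" where "v = (\<chi> i. if i \<in> J w then 0 else nat (m i))"
    have uv: "int (u $ k) - int (v $ k) = (if k = j then N else 0) - (if k \<in> - J w then m k else 0)" for k
      using j N by (auto simp: u_def v_def)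
    have "(A *v (\<chi> k. int (u $ k))) $ i - (A *v (\<chi> k. int (v $ k))) $ i = 0" for i
    proof -
      have "(A *v (\<chi> k. int (u $ k))) $ i - (A *v (\<chi> k. int (v $ k))) $ i
          = (\<Sum>k\<in>UNIV. A $ i $ k * (int (u $ k) - int (v $ k)))"
        by (simp add: matrix_vector_mult_def sum_subtractf right_diff_distrib)
      also have "\<dots> = (\<Sum>k\<in>UNIV. if k = j then A $ i $ k * N else 0)
          - (\<Sum>k\<in>UNIV. if k \<in> - J w then A $ i $ k * m k else 0)"
        unfolding uv sum_subtractf[symmetric] by (rule sum.cong) (auto simp: algebra_simps)
      also have "\<dots> = A $ i $ j * N - (\<Sum>k\<in>- J w. A $ i $ k * m k)"
        using sum.inter_restrict[of UNIV "\<lambda>k. A $ i $ k * m k" "- J w"] by simp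
      also have "\<dots> = 0" using m[of i] by (simp add: column_def mult_ac)
      finally show ?thesis .
    qed
    then have "A *v (\<chi> k. int (u $ k)) = A *v (\<chi> k. int (v $ k))" by (simp add: vec_eq_iff)
    moreover have "(\<chi> k. int ((w + u) $ k)) = (\<chi> k. int (w $ k)) + (\<chi> k. int (u $ k))" for u
      by (simp add: vec_eq_iff)
    ultimately have eq: "A *v (\<chi> k. int ((w + u) $ k)) = A *v (\<chi> k. int ((w + v) $ k))"
      by (simp add: matrix_vector_right_distrib del: vector_add_component)
    have "u $ j > 0" using N by (simp add: u_def)
    then obtain u' where u': "u = u' + axis j 1" by (rule nat_vec_split)
    have "w + u \<in> Z"
      using ideal'[of "w + axis j 1" u'] j by (simp add: u' J_def add_ac)
    then have "w + v \<in> Z" using toric[OF eq] by simp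
    moreover have "w + v \<notin> Z" by (rule off) (simp add: v_def)
    ultimately show False by simp
  qed
qed

section \<open>Holomorphic functions of several variables\<close>

text \<open>This class is a convenient substitute for \<open>holomorphic_several\<close>: it is closed under partial
  derivatives by the one-variable Cauchy formula and differentiation under the integral sign, and no
  total derivative of a derivative is ever needed.\<close>

definition separately_holomorphic :: "(complex ^ 'n::finite \<Rightarrow> complex) \<Rightarrow> (complex ^ 'n) set \<Rightarrow> bool" where
  "separately_holomorphic f V \<longleftrightarrow> continuous_on V f \<and>
     (\<forall>x\<in>V. \<forall>j. (\<lambda>t. f (x + axis j t)) field_differentiable at 0)"

lemma axis_zero: "axis j 0 = (0 :: 'a::zero ^ 'n::finite)"
  by (simp add: vec_eq_iff axis_def)

lemma axis_add: "axis j (s + t) = axis j s + (axis j t :: 'a::monoid_add ^ 'n::finite)"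
  by (simp add: vec_eq_iff axis_def)

lemma axis_minus: "axis j (s - t) = axis j s - (axis j t :: 'a::group_add ^ 'n::finite)"
  by (simp add: vec_eq_iff axis_def)

lemma norm_axis_complex [simp]: "norm (axis j t :: complex ^ 'n::finite) = norm t"
  by (simp add: norm_vec_def L2_set_def axis_def if_distrib[of norm] if_distrib[of "\<lambda>x. x\<^sup>2"] cong: if_cong)

lemma bounded_linear_axis: "bounded_linear (axis j :: complex \<Rightarrow> complex ^ 'n::finite)"
  by (rule bounded_linear_intro[where K = 1]) (simp add: axis_add, simp add: vec_eq_iff axis_def, simp)

lemmas continuous_on_axis [continuous_intros] =
  bounded_linear.continuous_on[OF bounded_linear_axis]

lemma holomorphic_several_imp_separately_holomorphic:
  fixes f :: "complex ^ 'n::finite \<Rightarrow> complex"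
  assumes "holomorphic_several f U" "V \<subseteq> U"
  shows "separately_holomorphic f V"
  unfolding separately_holomorphic_def
proof (intro conjI ballI allI)
  show "continuous_on V f"
    using assms unfolding holomorphic_several_def
    by (meson continuous_at_imp_continuous_on has_derivative_continuous subsetD)
next
  fix x j assume "x \<in> V"
  then obtain c :: "complex ^ 'n" where c: "(f has_derivative (\<lambda>h. \<Sum>j\<in>UNIV. c $ j * h $ j)) (at x)"
    using assms unfolding holomorphic_several_def by blast
  have "((\<lambda>t. x + axis j t) has_derivative axis j) (at (0::complex))"
    using has_derivative_add[OF has_derivative_const
      bounded_linear.has_derivative[OF bounded_linear_axis has_derivative_ident]] by simp
  then have "((\<lambda>t. f (x + axis j t)) has_derivative (\<lambda>t. \<Sum>k\<in>UNIV. c $ k * axis j t $ k)) (at 0)"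
    using has_derivative_compose[of "\<lambda>t. x + axis j t" "axis j" 0 UNIV f "\<lambda>h. \<Sum>j\<in>UNIV. c $ j * h $ j"] c
    by (simp add: axis_zero)
  moreover have "(\<Sum>k\<in>UNIV. c $ k * axis j t $ k) = c $ j * t" for t
    by (simp add: axis_def if_distrib cong: if_cong)
  ultimately show "(\<lambda>t. f (x + axis j t)) field_differentiable at 0"
    unfolding field_differentiable_def has_field_derivative_def by auto
qed

lemma partial_deriv_cong:
  assumes "open V" "x \<in> V" "\<And>y. y \<in> V \<Longrightarrow> f y = g y"
  shows "partial_deriv j f x = partial_deriv j g x"
proof -
  have "((\<lambda>t. x + axis j t) \<longlongrightarrow> x + axis j 0) (at (0::complex))"
    by (intro continuous_on_tendsto_compose[of UNIV "\<lambda>t. x + axis j t"] continuous_intros) auto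
  then have "\<forall>\<^sub>F t in nhds 0. x + axis j t \<in> V"
    using assms by (intro topological_tendstoD) (auto simp: tendsto_nhds_iff axis_zero)
  then have "\<forall>\<^sub>F t in nhds 0. f (x + axis j t) = g (x + axis j t)"
    by (rule eventually_mono) (use assms(3) in blast)
  then show ?thesis unfolding partial_deriv_def by (rule deriv_cong_ev) simp
qed

text \<open>The definition speaks of the parameter 0 only; moving the base point along the line
  gives every other parameter.\<close>

lemma separately_holomorphic_line:
  assumes "separately_holomorphic f V" "x + axis j t \<in> V"
  shows "((\<lambda>t. f (x + axis j t)) has_field_derivative partial_deriv j f (x + axis j t)) (at t)"
proof -
  have "(\<lambda>s. f ((x + axis j t) + axis j s)) field_differentiable at 0"
    using assms unfolding separately_holomorphic_def by blast
  then have "((\<lambda>s. f ((x + axis j t) + axis j s)) has_field_derivative partial_deriv j f (x + axis j t)) (at 0)"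
    unfolding partial_deriv_def using field_differentiable_derivI by blast
  then have "((\<lambda>s. f ((x + axis j t) + axis j (s - t))) has_field_derivative partial_deriv j f (x + axis j t)) (at t)"
    using DERIV_shift[of "\<lambda>s. f ((x + axis j t) + axis j (s - t))" _ 0 t] by (simp add: add_ac)
  then show ?thesis by (simp add: axis_minus)
qed

text \<open>The parametrisation of the circle by the unit interval makes the factor \<open>2 \<pi> i\<close> of Cauchy's
  formula cancel.\<close>

definition circle_param :: "real \<Rightarrow> real \<Rightarrow> complex" where
  "circle_param r s = of_real r * exp (2 * of_real pi * \<i> * of_real s)"

lemma norm_circle_param: "r > 0 \<Longrightarrow> norm (circle_param r s) = r"
  by (simp add: circle_param_def norm_mult)

lemma circle_param_nonzero: "r > 0 \<Longrightarrow> circle_param r s \<noteq> 0"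
  by (simp add: circle_param_def)

lemma continuous_on_circle_param [continuous_intros]:
  "continuous_on S g \<Longrightarrow> continuous_on S (\<lambda>x. circle_param r (g x))"
  unfolding circle_param_def by (intro continuous_intros) auto

text \<open>Cauchy's formula in the single direction \<open>j\<close>, where du = 2 pi i u ds
  removes one of the two factors u. Since the integrand contains \<open>f\<close> and no derivative,
  regularity of \<open>f\<close> in the base point passes to the partial derivative.\<close>

lemma partial_deriv_eq_integral:
  assumes f: "separately_holomorphic f V" and r: "r > 0" and sub: "cball x r \<subseteq> V"
  shows "partial_deriv j f x = integral {0..1} (\<lambda>s. f (x + axis j (circle_param r s)) / circle_param r s)"
proof -
  let ?\<phi> = "\<lambda>t. f (x + axis j t)"
  have V: "x + axis j t \<in> V" if "norm t \<le> r" for t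
    using that sub by (auto simp: dist_norm)
  have d: "(?\<phi> has_field_derivative partial_deriv j f (x + axis j t)) (at t)" if "norm t \<le> r" for t
    using separately_holomorphic_line[OF f V[OF that]] .
  have c: "continuous_on (cball 0 r) ?\<phi>"
    by (intro continuous_at_imp_continuous_on ballI DERIV_isCont[OF d]) auto
  have h: "?\<phi> holomorphic_on ball 0 r"
    by (auto simp: holomorphic_on_open intro!: exI d)
  have "(?\<phi> has_field_derivative (1 / (2 * of_real pi * \<i>) *
      contour_integral (circlepath 0 r) (\<lambda>u. ?\<phi> u / (u - 0)^2))) (at 0)"
    by (rule Cauchy_derivative_integral_circlepath(2)[OF c h]) (use r in simp)
  from DERIV_unique[OF this d[of 0]]
  have "partial_deriv j f x = 1 / (2 * of_real pi * \<i>) *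
      contour_integral (circlepath 0 r) (\<lambda>u. ?\<phi> u / u^2)"
    using r by (simp add: axis_zero)
  also have "contour_integral (circlepath 0 r) (\<lambda>u. ?\<phi> u / u^2) =
     integral {0..1} (\<lambda>s. 2 * of_real pi * \<i> * (?\<phi> (circle_param r s) / circle_param r s))"
    unfolding contour_integral_integral
  proof (rule integral_cong)
    fix s :: real
    have "circlepath 0 r s = circle_param r s"
      by (simp add: circlepath circle_param_def)
    moreover have "vector_derivative (circlepath 0 r) (at s) = 2 * of_real pi * \<i> * circle_param r s"
      by (simp add: vector_derivative_circlepath circle_param_def)
    ultimately show "?\<phi> (circlepath 0 r s) / (circlepath 0 r s)^2 * vector_derivative (circlepath 0 r) (at s) =
        2 * of_real pi * \<i> * (?\<phi> (circle_param r s) / circle_param r s)"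
      using circle_param_nonzero[OF r, of s] by (simp add: power2_eq_square)
  qed
  also have "1 / (2 * of_real pi * \<i>) * \<dots> =
      integral {0..1} (\<lambda>s. ?\<phi> (circle_param r s) / circle_param r s)"
    by (simp only: integral_mult_right) simp
  finally show ?thesis .
qed

text \<open>The doubled radius leaves room to move the centre: the same \<open>r\<close> serves in
  Cauchy's formula for all base points in \<open>ball x r\<close>.\<close>

lemma shifted_circle_in:
  assumes "cball x (2 * r) \<subseteq> V" "r > 0" "y \<in> ball x r"
  shows "y + axis j (circle_param r s) \<in> V" and "cball y r \<subseteq> V"
proof -
  show "cball y r \<subseteq> V"
  proof
    fix z assume "z \<in> cball y r"
    then have "dist x z \<le> 2 * r"
      using assms(3) dist_triangle[of x z y] by auto
    then show "z \<in> V" using assms(1) by auto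
  qed
  then show "y + axis j (circle_param r s) \<in> V"
    using assms(2) by (force simp: dist_norm norm_circle_param)
qed

lemma obtain_double_cball:
  fixes x :: "'a::metric_space"
  assumes "open V" "x \<in> V"
  obtains r where "r > 0" "cball x (2 * r) \<subseteq> V"
proof -
  obtain e where "e > 0" "cball x e \<subseteq> V" using assms open_contains_cball by blast
  then show thesis using that[of "e / 2"] by simp
qed

lemma continuous_on_partial_deriv:
  assumes f: "separately_holomorphic f V" and V: "open V"
  shows "continuous_on V (partial_deriv j f)"
proof (intro continuous_at_imp_continuous_on ballI)
  fix x assume x: "x \<in> V"
  obtain r where r: "r > 0" "cball x (2 * r) \<subseteq> V" using obtain_double_cball[OF V x] by metis
  note in_V = shifted_circle_in[OF r(2) r(1)]
  have fc: "continuous_on V f" using f unfolding separately_holomorphic_def by blast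
  have "continuous_on (ball x r) (\<lambda>y. integral (cbox 0 1) (\<lambda>s. f (y + axis j (circle_param r s)) / circle_param r s))"
  proof (rule integral_continuous_on_param)
    show "continuous_on (ball x r \<times> cbox 0 1) (\<lambda>(y, s). f (y + axis j (circle_param r s)) / circle_param r s)"
      unfolding split_beta
      by (intro continuous_intros continuous_on_compose2[OF fc])
        (use in_V r in \<open>auto simp: circle_param_nonzero\<close>)
  qed
  then have "continuous_on (ball x r) (partial_deriv j f)"
    by (rule continuous_on_eq) (use partial_deriv_eq_integral[OF f r(1) in_V(2)] in simp)
  then show "isCont (partial_deriv j f) x"
    using r by (simp add: continuous_on_eq_continuous_at)
qed

lemma separately_holomorphic_partial_deriv:
  assumes f: "separately_holomorphic f V" and V: "open V"
  shows "separately_holomorphic (partial_deriv j f) V"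
    and "x \<in> V \<Longrightarrow> partial_deriv k (partial_deriv j f) x = partial_deriv j (partial_deriv k f) x"
proof -
  have *: "\<exists>r>0. cball x r \<subseteq> V \<and> ((\<lambda>t. partial_deriv j f (x + axis k t)) has_field_derivative
      integral {0..1} (\<lambda>s. partial_deriv k f (x + axis j (circle_param r s)) / circle_param r s)) (at 0)"
    if "x \<in> V" for x j k
  proof -
    obtain r where r: "r > 0" "cball x (2 * r) \<subseteq> V" using obtain_double_cball[OF V \<open>x \<in> V\<close>] by metis
    have ball: "x + axis k t \<in> ball x r" if "t \<in> ball 0 r" for t
      using that by (simp add: dist_norm)
    note in_V = shifted_circle_in[OF r(2) r(1) ball]
    have fc: "continuous_on V f" using f unfolding separately_holomorphic_def by blast
    \<comment> \<open>Differentiation in direction \<open>k\<close> under the integral sign of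
      Cauchy's formula for direction \<open>j\<close>.\<close>
    have "((\<lambda>t. integral (cbox 0 1) (\<lambda>s. f (x + axis k t + axis j (circle_param r s)) / circle_param r s))
        has_field_derivative
        integral (cbox 0 1) (\<lambda>s. partial_deriv k f (x + axis k 0 + axis j (circle_param r s)) / circle_param r s))
        (at 0 within ball 0 r)"
    proof (rule leibniz_rule_field_derivative)
      fix t s assume t: "t \<in> ball (0::complex) r"
      have "((\<lambda>t. f (x + axis j (circle_param r s) + axis k t)) has_field_derivative
          partial_deriv k f (x + axis j (circle_param r s) + axis k t)) (at t)"
        by (rule separately_holomorphic_line[OF f]) (use in_V(1)[OF t, of j s] in \<open>simp add: add_ac\<close>)
      from DERIV_cdivide[OF this, of "circle_param r s"]
      show "((\<lambda>t. f (x + axis k t + axis j (circle_param r s)) / circle_param r s) has_field_derivative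
          partial_deriv k f (x + axis k t + axis j (circle_param r s)) / circle_param r s) (at t within ball 0 r)"
        by (simp add: add_ac has_field_derivative_at_within)
    next
      fix t assume t: "t \<in> ball (0::complex) r"
      show "(\<lambda>s. f (x + axis k t + axis j (circle_param r s)) / circle_param r s) integrable_on cbox 0 1"
        by (intro integrable_continuous continuous_intros continuous_on_compose2[OF fc])
          (use in_V(1)[OF t] r in \<open>auto simp: circle_param_nonzero\<close>)
    next
      show "continuous_on (ball 0 r \<times> cbox 0 1)
          (\<lambda>(t, s). partial_deriv k f (x + axis k t + axis j (circle_param r s)) / circle_param r s)"
        unfolding split_beta
        by (intro continuous_intros continuous_on_compose2[OF continuous_on_partial_deriv[OF f V]])
          (use in_V(1) r in \<open>auto simp: circle_param_nonzero\<close>)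
    qed (simp_all add: r(1))
    then have int: "((\<lambda>t. integral {0..1} (\<lambda>s. f (x + axis k t + axis j (circle_param r s)) / circle_param r s))
        has_field_derivative
        integral {0..1} (\<lambda>s. partial_deriv k f (x + axis j (circle_param r s)) / circle_param r s)) (at 0)"
      using at_within_open[of "0::complex" "ball 0 r"] r(1)
      by (simp only: axis_zero add_0_right open_ball centre_in_ball interval_cbox[symmetric])
    have ev: "\<forall>\<^sub>F t in nhds 0. partial_deriv j f (x + axis k t) =
        integral {0..1} (\<lambda>s. f (x + axis k t + axis j (circle_param r s)) / circle_param r s)"
      by (rule eventually_mono[OF eventually_nhds_in_open[of "ball 0 r"]])
        (simp_all add: r(1) partial_deriv_eq_integral[OF f r(1) in_V(2)])
    have "((\<lambda>t. partial_deriv j f (x + axis k t)) has_field_derivative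
        integral {0..1} (\<lambda>s. partial_deriv k f (x + axis j (circle_param r s)) / circle_param r s)) (at 0)"
      by (rule DERIV_cong_ev[OF refl ev refl, THEN iffD2, OF int])
    moreover have "cball x r \<subseteq> V" using in_V(2)[of 0] r by (simp add: axis_zero)
    ultimately show ?thesis using r by blast
  qed
  show sh: "separately_holomorphic (partial_deriv j f) V" for j
    unfolding separately_holomorphic_def field_differentiable_def
    using * continuous_on_partial_deriv[OF f V] by blast
  assume "x \<in> V"
  then obtain r where r: "r > 0" "cball x r \<subseteq> V"
    and d: "((\<lambda>t. partial_deriv j f (x + axis k t)) has_field_derivative
      integral {0..1} (\<lambda>s. partial_deriv k f (x + axis j (circle_param r s)) / circle_param r s)) (at 0)"
    using * by blast
  \<comment> \<open>The derivative just computed is Cauchy's integral in direction \<open>j\<close>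
    for \<open>partial_deriv k f\<close>, so the symmetry of second derivatives comes with their
    existence.\<close>
  show "partial_deriv k (partial_deriv j f) x = partial_deriv j (partial_deriv k f) x"
    using DERIV_imp_deriv[OF d] partial_deriv_eq_integral[OF sh[of k] r, of j]
    by (simp add: partial_deriv_def[of k "partial_deriv j f"])
qed

section \<open>The identity theorem in several variables\<close>

lemma bounded_linear_vector_scalar_mult: "bounded_linear (\<lambda>t::complex. t *s (v :: complex ^ 'n::finite))"
proof -
  have "linear (\<lambda>t::complex. t *s v)"
    by (rule linearI) (simp_all add: vec_eq_iff algebra_simps)
  then show ?thesis by (rule linear_conv_bounded_linear[THEN iffD1])
qed

text \<open>The one-variable identity theorem on the complex line through \<open>w\<close> and
  \<open>y\<close>, which meets the ball in a convex set. The line need not be parallel to an axis,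
  so the chain rule along it uses the total derivative.\<close>

lemma holomorphic_several_zero_on_ball:
  fixes f :: "complex ^ 'n::finite \<Rightarrow> complex"
  assumes f: "holomorphic_several f (ball x r)"
    and W: "open W" "w \<in> W" "w \<in> ball x r" "\<And>y. y \<in> W \<Longrightarrow> f y = 0"
    and y: "y \<in> ball x r"
  shows "f y = 0"
proof -
  define g where "g t = t *s (y - w)" for t :: complex
  have g: "bounded_linear g"
    unfolding g_def by (rule bounded_linear_vector_scalar_mult)
  have contg: "continuous_on UNIV g" using g by (rule linear_continuous_on)
  define S where "S = g -` ball (x - w) r"
  \<comment> \<open>The parameters in \<open>S\<close> whose points lie in \<open>W\<close>: an open
    set around 0 on which the restricted function vanishes.\<close>
  define S0 where "S0 = S \<inter> g -` ((+) (- w) ` W)"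
  have S: "t \<in> S \<longleftrightarrow> w + g t \<in> ball x r" for t
    by (simp add: S_def dist_norm algebra_simps)
  have "open S" unfolding S_def by (rule open_vimage[OF open_ball contg])
  have "(\<lambda>t. f (w + g t)) field_differentiable at t" if "t \<in> S" for t
  proof -
    have "w + g t \<in> ball x r" using that S by simp
    from f[unfolded holomorphic_several_def, rule_format, OF this]
    obtain c :: "complex ^ 'n" where c: "(f has_derivative (\<lambda>h. \<Sum>j\<in>UNIV. c $ j * h $ j)) (at (w + g t))" ..
    have "((\<lambda>t. w + g t) has_derivative (\<lambda>t. 0 + g t)) (at t)"
      by (rule has_derivative_add[OF has_derivative_const bounded_linear.has_derivative[OF g has_derivative_ident]])
    from has_derivative_compose[OF this c]
    have "((\<lambda>t. f (w + g t)) has_derivative (\<lambda>t. (\<Sum>j\<in>UNIV. c $ j * (y - w) $ j) * t)) (at t)"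
      by (simp add: g_def sum_distrib_left sum_distrib_right algebra_simps)
    then show ?thesis unfolding field_differentiable_def has_field_derivative_def by auto
  qed
  then have hol: "(\<lambda>t. f (w + g t)) holomorphic_on S"
    using \<open>open S\<close> holomorphic_on_def field_differentiable_at_within by blast
  have "f (w + g 1) = 0"
  proof (rule analytic_continuation_open[where s = S0 and s' = S and g = "\<lambda>_. 0" and z = 1])
    show "open S0"
      unfolding S0_def by (intro open_Int \<open>open S\<close> open_vimage[OF open_translation[OF W(1)] contg])
    have "0 \<in> S0" using W by (auto simp: S0_def S g_def image_iff)
    then show "S0 \<noteq> {}" by auto
    show "connected S"
      unfolding S_def using g
      by (intro convex_connected convex_linear_vimage) (auto simp: bounded_linear.linear)
    show "1 \<in> S" unfolding S using y by (simp add: g_def)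
    show "f (w + g t) = 0" if "t \<in> S0" for t
      using that W(4) by (auto simp: S0_def)
  qed (auto simp: hol \<open>open S\<close> S0_def)
  then show ?thesis by (simp add: g_def)
qed

text \<open>The interior of the zero set is also closed in \<open>U\<close>: a ball in
  \<open>U\<close> that meets it lies in it, by the case of a ball.\<close>

lemma holomorphic_several_zero_on_connected:
  fixes f :: "complex ^ 'n::finite \<Rightarrow> complex"
  assumes f: "holomorphic_several f U" and U: "open U" "connected U"
    and V: "open V" "V \<subseteq> U" "V \<noteq> {}" "\<And>x. x \<in> V \<Longrightarrow> f x = 0"
    and x: "x \<in> U"
  shows "f x = 0"
proof -
  define W where "W = interior {x \<in> U. f x = 0}"
  have WU: "W \<subseteq> U" and f0: "\<And>y. y \<in> W \<Longrightarrow> f y = 0"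
    using interior_subset unfolding W_def by auto
  have "open W" by (simp add: W_def)
  have "V \<subseteq> W" unfolding W_def using V by (intro interior_maximal) auto
  have "open (U - W)"
    unfolding open_contains_ball
  proof
    fix x assume x: "x \<in> U - W"
    then obtain r where r: "r > 0" "ball x r \<subseteq> U" using U(1) openE by blast
    have "ball x r \<inter> W = {}"
    proof (rule ccontr)
      assume "ball x r \<inter> W \<noteq> {}"
      then obtain w where w: "w \<in> W" "w \<in> ball x r" by auto
      have "holomorphic_several f (ball x r)"
        using f r(2) unfolding holomorphic_several_def by blast
      from holomorphic_several_zero_on_ball[OF this \<open>open W\<close> w f0]
      have "ball x r \<subseteq> {x \<in> U. f x = 0}" using r by auto
      then have "ball x r \<subseteq> W" unfolding W_def by (intro interior_maximal) auto
      then show False using x r(1) by (meson DiffD2 centre_in_ball subsetD)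
    qed
    then show "\<exists>e>0. ball x e \<subseteq> U - W" using r by blast
  qed
  then have "U \<inter> W = {} \<or> U \<inter> (U - W) = {}"
    using connectedD[OF U(2) \<open>open W\<close>, of "U - W"] by auto
  then show ?thesis using x f0 V \<open>V \<subseteq> W\<close> by blast
qed

section \<open>Iterated derivatives and Euler operators\<close>

lemma separately_holomorphic_funpow:
  assumes "open V" "separately_holomorphic f V"
  shows "separately_holomorphic ((partial_deriv k ^^ n) f) V"
  by (induction n) (simp_all add: assms separately_holomorphic_partial_deriv(1))

lemma separately_holomorphic_foldr:
  assumes "open V" "separately_holomorphic f V"
  shows "separately_holomorphic (foldr (\<lambda>j. partial_deriv j ^^ n j) js f) V"
  by (induction js) (simp_all add: assms separately_holomorphic_funpow)

lemma separately_holomorphic_multi_deriv: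
  "open V \<Longrightarrow> separately_holomorphic f V \<Longrightarrow> separately_holomorphic (multi_deriv u f) V"
  unfolding multi_deriv_def by (rule separately_holomorphic_foldr)

lemma funpow_partial_deriv_cong:
  assumes "open V" "\<And>y. y \<in> V \<Longrightarrow> f y = g y" "x \<in> V"
  shows "(partial_deriv k ^^ n) f x = (partial_deriv k ^^ n) g x"
  using assms(3)
proof (induction n arbitrary: x)
  case (Suc n)
  show ?case using partial_deriv_cong[OF assms(1) Suc.prems Suc.IH] by simp
qed (simp add: assms(2))

lemma funpow_partial_deriv_commute:
  assumes "open V" "separately_holomorphic f V" "x \<in> V"
  shows "(partial_deriv k ^^ n) (partial_deriv j f) x = partial_deriv j ((partial_deriv k ^^ n) f) x"
  using assms(3)
proof (induction n arbitrary: x)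
  case (Suc n)
  have "(partial_deriv k ^^ Suc n) (partial_deriv j f) x
      = partial_deriv k (partial_deriv j ((partial_deriv k ^^ n) f)) x"
    using partial_deriv_cong[OF assms(1) Suc.prems Suc.IH] by simp
  also have "\<dots> = partial_deriv j ((partial_deriv k ^^ Suc n) f) x"
    using separately_holomorphic_partial_deriv(2)[OF separately_holomorphic_funpow[OF assms(1,2)] assms(1) Suc.prems]
    by simp
  finally show ?case .
qed simp

text \<open>The new derivative in \<open>j\<close> is commuted outwards past the variables in front
  of \<open>j\<close>; those behind it are unaffected, since \<open>j\<close> occurs only once in
  \<open>js\<close>.\<close>

lemma foldr_partial_deriv_Suc:
  assumes "open V" "separately_holomorphic f V" "distinct js" "j \<in> set js" "x \<in> V"
  shows "foldr (\<lambda>i. partial_deriv i ^^ ((u + axis j 1 :: nat ^ 'n::finite) $ i)) js f x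
    = partial_deriv j (foldr (\<lambda>i. partial_deriv i ^^ (u $ i)) js f) x"
  using assms(3-5)
proof (induction js arbitrary: x)
  case (Cons k js)
  let ?D = "\<lambda>u. foldr (\<lambda>i. partial_deriv i ^^ (u $ i)) js f"
  show ?case
  proof (cases "k = j")
    case True
    then have "?D (u + axis j 1) = ?D u"
      using Cons.prems by (intro foldr_cong) (auto simp: axis_def)
    then show ?thesis using True by (simp add: axis_def)
  next
    case False
    then have "foldr (\<lambda>i. partial_deriv i ^^ ((u + axis j 1) $ i)) (k # js) f x
        = (partial_deriv k ^^ (u $ k)) (?D (u + axis j 1)) x"
      by (simp add: axis_def)
    also have "\<dots> = (partial_deriv k ^^ (u $ k)) (partial_deriv j (?D u)) x"
      using False Cons by (intro funpow_partial_deriv_cong[OF assms(1)]) auto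
    also have "\<dots> = partial_deriv j ((partial_deriv k ^^ (u $ k)) (?D u)) x"
      using Cons.prems
      by (intro funpow_partial_deriv_commute[OF assms(1)] separately_holomorphic_foldr[OF assms(1,2)])
    finally show ?thesis by simp
  qed
qed simp

lemma multi_deriv_zero:
  fixes f :: "complex ^ 'n::{finite,linorder} \<Rightarrow> complex"
  shows "multi_deriv 0 f = f"
proof -
  have "foldr (\<lambda>j. partial_deriv j ^^ ((0 :: nat ^ 'n::_) $ j)) js f = f" for js
    by (induction js) auto
  then show ?thesis unfolding multi_deriv_def by blast
qed

lemma multi_deriv_add_axis:
  assumes "open V" "separately_holomorphic f V" "x \<in> V"
  shows "multi_deriv (u + axis j 1) f x = partial_deriv j (multi_deriv u f) x"
  unfolding multi_deriv_def using assms by (intro foldr_partial_deriv_Suc) auto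

lemma partial_deriv_const_mult:
  assumes "separately_holomorphic f V" "x \<in> V"
  shows "partial_deriv k (\<lambda>y. c * f y) x = c * partial_deriv k f x"
  using DERIV_imp_deriv[OF DERIV_cmult[OF separately_holomorphic_line[OF assms(1), of x k 0], of c]] assms(2)
  by (simp add: partial_deriv_def axis_zero)

text \<open>The commutator of the k-th derivative with the Euler operator of weight \<open>c\<close>
  is \<open>c k\<close> times that derivative, so differentiation lowers the degree by
  \<open>c k\<close>.\<close>

lemma euler_partial_deriv:
  assumes V: "open V" and g: "separately_holomorphic g V"
    and euler: "\<And>x. x \<in> V \<Longrightarrow> (\<Sum>j\<in>UNIV. c j * x $ j * partial_deriv j g x) = m * g x"
    and x: "x \<in> V"
  shows "(\<Sum>j\<in>UNIV. c j * x $ j * partial_deriv j (partial_deriv k g) x) = (m - c k) * partial_deriv k g x"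
proof -
  have sh: "separately_holomorphic (partial_deriv j g) V" for j
    using separately_holomorphic_partial_deriv(1)[OF g V] .
  have "((\<lambda>t. (x + axis k t) $ j) has_field_derivative (if j = k then 1 else 0)) (at 0)" for j
    by (auto simp: axis_def intro!: derivative_eq_intros)
  moreover have "((\<lambda>t. partial_deriv j g (x + axis k t)) has_field_derivative partial_deriv k (partial_deriv j g) x) (at 0)" for j
    using separately_holomorphic_line[OF sh, of x k 0 j] x by (simp add: axis_zero)
  ultimately have "((\<lambda>t. \<Sum>j\<in>UNIV. c j * ((x + axis k t) $ j * partial_deriv j g (x + axis k t))) has_field_derivative
      (\<Sum>j\<in>UNIV. c j * ((if j = k then 1 else 0) * partial_deriv j g (x + axis k 0)
        + partial_deriv k (partial_deriv j g) x * (x + axis k 0) $ j))) (at 0)"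
    by (intro DERIV_sum DERIV_cmult DERIV_mult)
  then have "partial_deriv k (\<lambda>y. \<Sum>j\<in>UNIV. c j * (y $ j * partial_deriv j g y)) x
     = (\<Sum>j\<in>UNIV. c j * ((if j = k then 1 else 0) * partial_deriv j g x + partial_deriv k (partial_deriv j g) x * x $ j))"
    unfolding partial_deriv_def[of k "\<lambda>y. \<Sum>j\<in>UNIV. c j * (y $ j * partial_deriv j g y)"]
    using DERIV_imp_deriv by (auto simp: axis_zero)
  also have "\<dots> = (\<Sum>j\<in>UNIV. if j = k then c j * partial_deriv j g x else 0) + (\<Sum>j\<in>UNIV. c j * x $ j * partial_deriv j (partial_deriv k g) x)"
    unfolding sum.distrib[symmetric]
    by (rule sum.cong) (auto simp: algebra_simps separately_holomorphic_partial_deriv(2)[OF g V x, of k])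
  also have "partial_deriv k (\<lambda>y. \<Sum>j\<in>UNIV. c j * (y $ j * partial_deriv j g y)) x = partial_deriv k (\<lambda>y. m * g y) x"
    by (rule partial_deriv_cong[OF V x]) (simp add: euler[symmetric] mult.assoc)
  also have "\<dots> = m * partial_deriv k g x" by (rule partial_deriv_const_mult[OF g x])
  finally show ?thesis by (simp add: algebra_simps)
qed

lemma euler_multi_deriv:
  assumes V: "open V" and f: "separately_holomorphic f V"
    and euler: "\<And>x. x \<in> V \<Longrightarrow> (\<Sum>j\<in>UNIV. c j * x $ j * partial_deriv j f x) = m * f x"
    and x: "x \<in> V"
  shows "(\<Sum>j\<in>UNIV. c j * x $ j * partial_deriv j (multi_deriv u f) x)
    = (m - (\<Sum>j\<in>UNIV. c j * of_nat (u $ j))) * multi_deriv u f x"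
  using x
proof (induction u arbitrary: x rule: nat_vec_induct)
  case zero
  then show ?case using euler by (simp add: multi_deriv_zero)
next
  case (add_axis u k)
  have "(\<Sum>j\<in>UNIV. c j * x $ j * partial_deriv j (multi_deriv (u + axis k 1) f) x)
      = (\<Sum>j\<in>UNIV. c j * x $ j * partial_deriv j (partial_deriv k (multi_deriv u f)) x)"
    using partial_deriv_cong[OF V add_axis.prems multi_deriv_add_axis[OF V f]] by simp
  also have "\<dots> = (m - (\<Sum>j\<in>UNIV. c j * of_nat (u $ j)) - c k) * partial_deriv k (multi_deriv u f) x"
    by (rule euler_partial_deriv[OF V separately_holomorphic_multi_deriv[OF V f] add_axis.IH add_axis.prems])
  also have "m - (\<Sum>j\<in>UNIV. c j * of_nat (u $ j)) - c k = m - (\<Sum>j\<in>UNIV. c j * of_nat ((u + axis k 1) $ j))"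
  proof -
    have "c j * of_nat ((u + axis k 1) $ j) = c j * of_nat (u $ j) + (if j = k then c k else 0)" for j
      by (simp add: axis_def algebra_simps)
    then show ?thesis by (simp add: sum.distrib)
  qed
  also have "partial_deriv k (multi_deriv u f) x = multi_deriv (u + axis k 1) f x"
    using multi_deriv_add_axis[OF V f add_axis.prems] by simp
  finally show ?case .
qed

section \<open>Generic parameters\<close>

lemma continuous_on_polynomial_function:
  "p \<in> polynomial_functions \<Longrightarrow> continuous_on S p"
  by (induction rule: polynomial_functions.induct) (intro continuous_intros | assumption)+

lemma polynomial_function_on_line:
  assumes "p \<in> polynomial_functions"
  shows "\<exists>q. \<forall>t. p (a + t *s v) = poly q t"
  using assms
proof induction
  case (const c)
  show ?case by (rule exI[of _ "[:c:]"]) simp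
next
  case (coord i)
  show ?case by (rule exI[of _ "[:a $ i, v $ i:]"]) simp
next
  case (add p q)
  then show ?case by (metis poly_add)
next
  case (mult p q)
  then show ?case by (metis poly_mult)
qed

text \<open>On the complex line from \<open>a\<close> to \<open>b\<close> the function is a nonzero
  polynomial in one variable, whose finitely many roots do not accumulate at
  \<open>a\<close>.\<close>

lemma dense_polynomial_nonzero:
  fixes p :: "complex ^ 'd::finite \<Rightarrow> complex"
  assumes p: "p \<in> polynomial_functions" and b: "p b \<noteq> 0"
  shows "closure {\<beta>. p \<beta> \<noteq> 0} = UNIV"
proof -
  have "a \<in> closure {\<beta>. p \<beta> \<noteq> 0}" for a
    unfolding closure_approachable
  proof (intro allI impI)
    fix e :: real assume "e > 0"
    obtain q where q: "\<And>t. p (a + t *s (b - a)) = poly q t"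
      using polynomial_function_on_line[OF p] by metis
    have "poly q 1 \<noteq> 0" using b q[of 1] by simp
    then have "q \<noteq> 0" by auto
    then have "\<forall>\<^sub>F t in at 0. t \<notin> {t. poly q t = 0}"
      using islimpt_finite[OF poly_roots_finite[of q]] islimpt_iff_eventually by blast
    moreover have "continuous_on UNIV (\<lambda>t. a + t *s (b - a))"
      unfolding vector_scalar_mult_def by (intro continuous_intros)
    then have "((\<lambda>t. a + t *s (b - a)) \<longlongrightarrow> a + 0 *s (b - a)) (at 0)"
      unfolding continuous_on_def by blast
    then have "\<forall>\<^sub>F t in at 0. dist (a + t *s (b - a)) a < e"
      using \<open>e > 0\<close> tendstoD by force
    ultimately have "\<forall>\<^sub>F t in at 0. poly q t \<noteq> 0 \<and> dist (a + t *s (b - a)) a < e"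
      by eventually_elim simp
    then obtain t where "poly q t \<noteq> 0" "dist (a + t *s (b - a)) a < e"
      using eventually_happens'[OF at_neq_bot] by blast
    then show "\<exists>y\<in>{\<beta>. p \<beta> \<noteq> 0}. dist y a < e"
      by (intro bexI[of _ "a + t *s (b - a)"]) (simp_all only: q mem_Collect_eq not_False_eq_True)
  qed
  then show ?thesis by auto
qed

text \<open>Baire's theorem: a countable intersection of dense open sets of nonzeros is dense, in
  particular nonempty.\<close>

lemma generic_ex:
  assumes "generic Q"
  shows "\<exists>\<beta>. Q \<beta>"
proof -
  obtain S where S: "S \<subseteq> polynomial_functions" "countable S" "(\<lambda>_. 0) \<notin> S"
    and Q: "\<And>\<beta>. \<forall>p\<in>S. p \<beta> \<noteq> 0 \<Longrightarrow> Q \<beta>"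
    using assms unfolding generic_def by blast
  let ?G = "(\<lambda>p. {\<beta>. p \<beta> \<noteq> 0}) ` S"
  have "UNIV \<subseteq> closure (\<Inter> ?G)"
  proof (rule Baire)
    show "countable ?G" using S by blast
    fix X assume "X \<in> ?G"
    then obtain p where p: "p \<in> S" "X = {\<beta>. p \<beta> \<noteq> 0}" by blast
    then have "p \<noteq> (\<lambda>_. 0)" using S by blast
    then obtain b where "p b \<noteq> 0" by blast
    then have "closure X = UNIV" using dense_polynomial_nonzero p S by blast
    moreover have "open X"
      using open_Collect_neq[OF continuous_on_polynomial_function[of p UNIV] continuous_on_const[of UNIV 0]] p S
      by auto
    ultimately show "openin (top_of_set UNIV) X \<and> UNIV \<subseteq> closure X" by simp
  qed simp
  then have "\<Inter> ?G \<noteq> {}" by auto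
  then show ?thesis using Q by auto
qed

lemma generic_mono: "generic Q \<Longrightarrow> (\<And>\<beta>. Q \<beta> \<Longrightarrow> R \<beta>) \<Longrightarrow> generic R"
  unfolding generic_def by blast

lemma generic_countable_Ball:
  assumes "countable I" "\<And>i. i \<in> I \<Longrightarrow> generic (Q i)"
  shows "generic (\<lambda>\<beta>. \<forall>i\<in>I. Q i \<beta>)"
proof -
  have "\<forall>i\<in>I. \<exists>S\<subseteq>polynomial_functions. countable S \<and> (\<lambda>_. 0) \<notin> S \<and> (\<forall>\<beta>. (\<forall>p\<in>S. p \<beta> \<noteq> 0) \<longrightarrow> Q i \<beta>)"
    using assms(2) unfolding generic_def by blast
  then obtain S where S: "\<And>i. i \<in> I \<Longrightarrow> S i \<subseteq> polynomial_functions \<and> countable (S i) \<and> (\<lambda>_. 0) \<notin> S i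
      \<and> (\<forall>\<beta>. (\<forall>p\<in>S i. p \<beta> \<noteq> 0) \<longrightarrow> Q i \<beta>)"
    by metis
  show ?thesis
    unfolding generic_def
  proof (intro exI[of _ "\<Union>i\<in>I. S i"] conjI)
    show "countable (\<Union>i\<in>I. S i)" using assms(1) S by (intro countable_UN) auto
  qed (use S in blast)+
qed

lemma generic_conj:
  assumes "generic Q" "generic R"
  shows "generic (\<lambda>\<beta>. Q \<beta> \<and> R \<beta>)"
proof -
  have "generic (\<lambda>\<beta>. \<forall>b\<in>UNIV. (if b then Q else R) \<beta>)"
    by (rule generic_countable_Ball) (simp_all add: assms)
  then show ?thesis by (rule generic_mono) (auto dest: spec[of _ True] spec[of _ False])
qed

lemma generic_affine_nonzero:
  fixes l :: "complex ^ 'd::finite"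
  assumes "l \<noteq> 0"
  shows "generic (\<lambda>\<beta>. (\<Sum>i\<in>UNIV. l $ i * \<beta> $ i) \<noteq> m)"
proof -
  let ?p = "\<lambda>\<beta> :: complex ^ 'd. (\<Sum>i\<in>UNIV. l $ i * \<beta> $ i) + (- m)"
  have "(\<lambda>\<beta>. \<Sum>i\<in>I. l $ i * \<beta> $ i) \<in> polynomial_functions" if "finite I" for I
    using that by induction (auto intro!: polynomial_functions.intros)
  then have "?p \<in> polynomial_functions"
    by (intro polynomial_functions.intros) simp_all
  moreover have "?p \<noteq> (\<lambda>_. 0)"
  proof
    assume p: "?p = (\<lambda>_. 0)"
    have "m = 0" using fun_cong[OF p, of 0] by simp
    obtain i where "l $ i \<noteq> 0" using assms by (auto simp: vec_eq_iff)
    moreover have "(\<Sum>j\<in>UNIV. l $ j * axis i 1 $ j) = l $ i"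
      by (simp add: axis_def if_distrib cong: if_cong)
    ultimately show False using fun_cong[OF p, of "axis i 1"] \<open>m = 0\<close> by simp
  qed
  ultimately show ?thesis
    unfolding generic_def by (intro exI[of _ "{?p}"]) auto
qed

text \<open>These inequalities keep the degree of every derivative of a solution nonzero under each
  nontrivial integral combination of Euler operators. There are only countably many pairs
  \<open>(l, m)\<close>.\<close>

lemma generic_nonresonant:
  "generic (\<lambda>\<beta> :: complex ^ 'd::finite. \<forall>l :: int ^ 'd. \<forall>m::int. l \<noteq> 0 \<longrightarrow> (\<Sum>i\<in>UNIV. of_int (l $ i) * \<beta> $ i) \<noteq> of_int m)"
proof -
  let ?R = "\<lambda>(l :: int ^ 'd, m :: int) \<beta> :: complex ^ 'd. (\<Sum>i\<in>UNIV. of_int (l $ i) * \<beta> $ i) \<noteq> of_int m"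
  have "generic (?R (l, m))" if "l \<noteq> 0" for l m
  proof -
    have "(\<chi> i. of_int (l $ i)) \<noteq> (0 :: complex ^ 'd)" using that by (simp add: vec_eq_iff)
    from generic_affine_nonzero[OF this, of "of_int m"] show ?thesis by simp
  qed
  then have "generic (\<lambda>\<beta>. \<forall>i\<in>{(l, m). l \<noteq> 0}. ?R i \<beta>)"
    by (intro generic_countable_Ball) (auto intro!: countableI_type)
  then show ?thesis by (rule generic_mono) auto
qed

section \<open>Symmetries of hypergeometric functions\<close>

lemma solves_H_toric:
  assumes "solves_H A \<beta> U f" "A *v (\<chi> j. int (u $ j)) = A *v (\<chi> j. int (v $ j))" "x \<in> U"
  shows "multi_deriv u f x = multi_deriv v f x"
proof -
  have "multi_deriv u f x - multi_deriv v f x = 0"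
    using assms(1)[unfolded solves_H_def, THEN conjunct1, rule_format, OF assms(2,3)] .
  then show ?thesis by simp
qed

lemma solves_H_euler:
  "solves_H A \<beta> U f \<Longrightarrow> x \<in> U \<Longrightarrow>
    (\<Sum>j\<in>UNIV. of_int (A $ i $ j) * x $ j * partial_deriv j f x) = \<beta> $ i * f x"
  by (simp add: solves_H_def)

text \<open>Combining the Euler equations with coefficients \<open>l\<close> gives an operator of
  weight c = l A, for which the \<open>w\<close>-th derivative has degree l \<beta> - c w.
  Nonresonance makes this degree nonzero, so some term of the Euler sum survives wherever that
  derivative does.\<close>

lemma multi_deriv_not_zero:
  fixes A :: "int ^ 'n::{finite,linorder} ^ 'd::finite"
  assumes V: "open V" and f: "separately_holomorphic f V" "\<exists>x\<in>V. f x \<noteq> 0" "solves_H A \<beta> V f"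
    and \<beta>: "\<And>(l :: int ^ 'd) m :: int. l \<noteq> 0 \<Longrightarrow> (\<Sum>i\<in>UNIV. of_int (l $ i) * \<beta> $ i) \<noteq> of_int m"
  shows "\<exists>x\<in>V. multi_deriv u f x \<noteq> 0"
proof -
  define Z where "Z = {u. \<forall>x\<in>V. multi_deriv u f x = 0}"
  have "Z = {}"
  proof (rule toric_ideal_empty[of Z A])
    show "0 \<notin> Z" using f(2) by (simp add: Z_def multi_deriv_zero)
  next
    fix w j assume "w \<in> Z"
    have "multi_deriv (w + axis j 1) f x = 0" if x: "x \<in> V" for x
    proof -
      have "multi_deriv (w + axis j 1) f x = partial_deriv j (multi_deriv w f) x"
        by (rule multi_deriv_add_axis[OF V f(1) x])
      also have "\<dots> = partial_deriv j (\<lambda>_. 0) x"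
        by (rule partial_deriv_cong[OF V x]) (use \<open>w \<in> Z\<close> in \<open>simp add: Z_def\<close>)
      finally show ?thesis by (simp add: partial_deriv_def)
    qed
    then show "w + axis j 1 \<in> Z" unfolding Z_def by blast
  next
    fix u v :: "nat ^ 'n::_" assume "A *v (\<chi> j. int (u $ j)) = A *v (\<chi> j. int (v $ j))" "u \<in> Z"
    then show "v \<in> Z" unfolding Z_def using solves_H_toric[OF f(3), of u v] by auto
  next
    fix w and l :: "int ^ 'd" assume w: "w \<notin> Z" and l: "l \<noteq> 0"
    then obtain x where x: "x \<in> V" "multi_deriv w f x \<noteq> 0" by (auto simp: Z_def)
    define c where "c k = (\<Sum>i\<in>UNIV. l $ i * A $ i $ k)" for k
    have "(\<Sum>k\<in>UNIV. of_int (c k) * x $ k * partial_deriv k f x) = (\<Sum>i\<in>UNIV. of_int (l $ i) * \<beta> $ i) * f x"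
      if "x \<in> V" for x
    proof -
      have "(\<Sum>k\<in>UNIV. of_int (c k) * x $ k * partial_deriv k f x)
          = (\<Sum>k\<in>UNIV. \<Sum>i\<in>UNIV. of_int (l $ i) * (of_int (A $ i $ k) * x $ k * partial_deriv k f x))"
        by (simp add: c_def sum_distrib_left sum_distrib_right mult_ac)
      also have "\<dots> = (\<Sum>i\<in>UNIV. of_int (l $ i) * (\<Sum>k\<in>UNIV. of_int (A $ i $ k) * x $ k * partial_deriv k f x))"
        by (subst sum.swap) (simp add: sum_distrib_left)
      also have "\<dots> = (\<Sum>i\<in>UNIV. of_int (l $ i) * (\<beta> $ i * f x))"
        using that by (simp add: solves_H_euler[OF f(3)])
      finally show ?thesis by (simp add: sum_distrib_right mult.assoc)
    qed
    from euler_multi_deriv[OF V f(1) this x(1)]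
    have e: "(\<Sum>k\<in>UNIV. of_int (c k) * x $ k * partial_deriv k (multi_deriv w f) x)
      = ((\<Sum>i\<in>UNIV. of_int (l $ i) * \<beta> $ i) - of_int (\<Sum>k\<in>UNIV. c k * int (w $ k))) * multi_deriv w f x"
      by simp
    show "\<exists>k. (\<Sum>i\<in>UNIV. l $ i * A $ i $ k) \<noteq> 0 \<and> w + axis k 1 \<notin> Z"
    proof (rule ccontr)
      assume *: "\<not> ?thesis"
      have "of_int (c k) * x $ k * partial_deriv k (multi_deriv w f) x = 0" for k
      proof (cases "c k = 0")
        case False
        then have "w + axis k 1 \<in> Z" using * unfolding c_def by blast
        then show ?thesis
          using multi_deriv_add_axis[OF V f(1) x(1), of w k] x(1) unfolding Z_def by simp
      qed simp
      then have "(\<Sum>k\<in>UNIV. of_int (c k) * x $ k * partial_deriv k (multi_deriv w f) x) = 0"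
        by (intro sum.neutral ballI)
      then have "(\<Sum>i\<in>UNIV. of_int (l $ i) * \<beta> $ i) = of_int (\<Sum>k\<in>UNIV. c k * int (w $ k))"
        using e x(2) by (simp del: of_int_sum)
      then show False using \<beta>[OF l] by blast
    qed
  qed
  then show ?thesis by (auto simp: Z_def)
qed

text \<open>If the weight \<open>c\<close> separates \<open>u\<close> from \<open>v\<close> with \<open>A u = A v\<close>, then the two equal derivatives of
  \<open>f\<close> with multi-indices \<open>u\<close> and \<open>v\<close> are homogeneous of different degrees, so they vanish.\<close>

lemma homogeneity_in_row_space:
  fixes A :: "int ^ 'n::{finite,linorder} ^ 'd::finite" and c :: "int ^ 'n::_"
  assumes V: "open V" and f: "separately_holomorphic f V" "\<exists>x\<in>V. f x \<noteq> 0" "solves_H A \<beta> V f"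
    and \<beta>: "\<And>(l :: int ^ 'd) m :: int. l \<noteq> 0 \<Longrightarrow> (\<Sum>i\<in>UNIV. of_int (l $ i) * \<beta> $ i) \<noteq> of_int m"
    and euler: "\<And>x. x \<in> V \<Longrightarrow> (\<Sum>j\<in>UNIV. of_int (c $ j) * x $ j * partial_deriv j f x) = \<mu> * f x"
  shows "\<exists>N m. N > 0 \<and> (\<forall>j. N * c $ j = (\<Sum>i\<in>UNIV. m i * A $ i $ j))"
proof (rule ccontr)
  assume "\<not> ?thesis"
  then obtain l :: "int ^ 'n::_" where l: "\<And>i. (\<Sum>j\<in>UNIV. l $ j * A $ i $ j) = 0" "(\<Sum>j\<in>UNIV. l $ j * c $ j) \<noteq> 0"
    using int_span_or_separated[of UNIV c "\<lambda>i. A $ i"] by auto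
  \<comment> \<open>Positive and negative parts of the kernel vector \<open>l\<close>, so that
    \<open>A l = 0\<close> reads \<open>A u = A v\<close>.\<close>
  define u :: "nat ^ 'n::_" where "u = (\<chi> j. nat (l $ j))"
  define v :: "nat ^ 'n::_" where "v = (\<chi> j. nat (- l $ j))"
  have uv: "int (u $ j) = l $ j + int (v $ j)" for j by (simp add: u_def v_def)
  have "A *v (\<chi> j. int (u $ j)) = A *v (\<chi> j. int (v $ j))"
    using l(1) by (simp add: vec_eq_iff matrix_vector_mult_def uv distrib_left sum.distrib mult.commute)
  then have eq: "multi_deriv u f x = multi_deriv v f x" if "x \<in> V" for x
    using solves_H_toric[OF f(3)] that by blast
  obtain x where x: "x \<in> V" "multi_deriv u f x \<noteq> 0"
    using multi_deriv_not_zero[OF V f \<beta>] by blast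
  have "partial_deriv j (multi_deriv u f) x = partial_deriv j (multi_deriv v f) x" for j
    by (rule partial_deriv_cong[OF V x(1) eq])
  then have "(\<mu> - (\<Sum>j\<in>UNIV. of_int (c $ j) * of_nat (u $ j))) * multi_deriv u f x
      = (\<mu> - (\<Sum>j\<in>UNIV. of_int (c $ j) * of_nat (v $ j))) * multi_deriv u f x"
    using euler_multi_deriv[OF V f(1) euler x(1), of u] euler_multi_deriv[OF V f(1) euler x(1), of v] eq[OF x(1)]
    by auto
  then have "(of_int (\<Sum>j\<in>UNIV. c $ j * int (u $ j)) :: complex) = of_int (\<Sum>j\<in>UNIV. c $ j * int (v $ j))"
    using x(2) by simp
  then have "(\<Sum>j\<in>UNIV. c $ j * int (u $ j)) = (\<Sum>j\<in>UNIV. c $ j * int (v $ j))"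
    by (simp only: of_int_eq_iff)
  then show False
    using l(2) by (simp add: uv distrib_left sum.distrib mult.commute)
qed

section \<open>The substitution x P and its effect on Euler operators\<close>

lemma vector_matrix_mult_permutation:
  fixes x :: "'a::semiring_1 ^ 'n::finite"
  assumes "P = (\<chi> i j. if i = \<sigma> j then 1 else 0)"
  shows "(x v* P) $ j = x $ \<sigma> j"
  by (simp add: vector_matrix_mult_def assms if_distrib cong: if_cong)

text \<open>Moving x along axis \<open>\<sigma> j\<close> moves x P along axis \<open>j\<close>, so
  the chain rule stays within one variable and separate holomorphy of \<open>g\<close> is
  enough.\<close>

lemma partial_deriv_permuted:
  fixes f g :: "complex ^ 'n::finite \<Rightarrow> complex"
  assumes \<sigma>: "\<sigma> permutes UNIV" and P: "P = (\<chi> i j. if i = \<sigma> j then 1 else 0)"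
    and V: "open V" "x \<in> V" and fg: "\<And>y. y \<in> V \<Longrightarrow> f y = c * g (y v* P)"
    and g: "separately_holomorphic g U" "x v* P \<in> U"
  shows "partial_deriv (\<sigma> j) f x = c * partial_deriv j g (x v* P)"
proof -
  have "axis (\<sigma> j) t v* P = axis j t" for t
    using permutes_inj[OF \<sigma>]
    by (simp add: vec_eq_iff vector_matrix_mult_permutation[OF P] axis_def inj_eq)
  then have line: "(x + axis (\<sigma> j) t) v* P = x v* P + axis j t" for t
    by (simp add: vector_matrix_left_distrib)
  have "partial_deriv (\<sigma> j) f x = partial_deriv (\<sigma> j) (\<lambda>y. c * g (y v* P)) x"
    by (rule partial_deriv_cong[OF V fg])
  also have "\<dots> = partial_deriv j (\<lambda>y. c * g y) (x v* P)"
    by (simp add: partial_deriv_def line)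
  also have "\<dots> = c * partial_deriv j g (x v* P)"
    by (rule partial_deriv_const_mult[OF g])
  finally show ?thesis .
qed

lemma euler_transformed:
  fixes A :: "int ^ 'n::{finite,linorder} ^ 'd::finite"
  assumes \<sigma>: "\<sigma> permutes UNIV" and P: "P = (\<chi> i j. if i = \<sigma> j then 1 else 0)"
    and V: "open V" "x \<in> V" and fg: "\<And>y. y \<in> V \<Longrightarrow> f y = c * g (y v* P)"
    and g: "separately_holomorphic g U" "x v* P \<in> U" "solves_H A \<beta> U g"
  shows "(\<Sum>k\<in>UNIV. of_int (A $ i $ inv \<sigma> k) * x $ k * partial_deriv k f x) = \<beta> $ i * f x"
proof -
  have "(\<Sum>k\<in>UNIV. of_int (A $ i $ inv \<sigma> k) * x $ k * partial_deriv k f x)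
      = (\<Sum>j\<in>UNIV. of_int (A $ i $ j) * x $ \<sigma> j * partial_deriv (\<sigma> j) f x)"
    by (subst sum.permute[OF \<sigma>]) (simp add: permutes_inverses[OF \<sigma>])
  also have "\<dots> = c * (\<Sum>j\<in>UNIV. of_int (A $ i $ j) * (x v* P) $ j * partial_deriv j g (x v* P))"
    by (simp add: partial_deriv_permuted[OF \<sigma> P V fg g(1,2)] vector_matrix_mult_permutation[OF P] sum_distrib_left mult_ac)
  also have "\<dots> = \<beta> $ i * f x"
    by (simp add: solves_H_euler[OF g(3,2)] fg[OF V(2)])
  finally show ?thesis .
qed

text \<open>Passing to the small set on which the transformation holds; that \<open>f\<close> stays
  nonzero there is the identity theorem on the connected domain \<open>U\<close>.\<close>

lemma A_hypergeometric_local: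
  assumes f: "A_hypergeometric A \<beta> U f" and V: "open V" "V \<noteq> {}" "V \<subseteq> U"
  shows "separately_holomorphic f V" "\<exists>x\<in>V. f x \<noteq> 0" "solves_H A \<beta> V f"
proof -
  have hol: "holomorphic_several f U" and U: "open U" "connected U"
    using f by (auto simp: A_hypergeometric_def)
  show "separately_holomorphic f V"
    using hol V(3) by (rule holomorphic_several_imp_separately_holomorphic)
  show "\<exists>x\<in>V. f x \<noteq> 0"
    using holomorphic_several_zero_on_connected[OF hol U V(1,3,2)] f
    unfolding A_hypergeometric_def by blast
  show "solves_H A \<beta> V f"
    using f V(3) unfolding A_hypergeometric_def solves_H_def by blast
qed

lemma surj_right_inverse:
  fixes A :: "int ^ 'n::finite ^ 'd::finite"
  assumes "surj (\<lambda>c :: int ^ 'n. A *v c)"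
  shows "\<exists>C :: complex ^ 'd ^ 'n. map_matrix of_int A ** C = mat 1"
proof -
  \<comment> \<open>Integral preimages of the unit vectors become the columns of the right
    inverse.\<close>
  define c where "c i = (SOME x. A *v x = axis i 1)" for i
  have c: "A *v c i = axis i 1" for i
    unfolding c_def by (rule someI_ex) (metis assms surjD)
  have "(map_matrix of_int A ** (\<chi> j i. of_int (c i $ j))) $ k $ i = (mat 1 :: complex ^ 'd ^ 'd) $ k $ i" for k i
  proof -
    have "(map_matrix of_int A ** (\<chi> j i. of_int (c i $ j))) $ k $ i = (of_int ((A *v c i) $ k) :: complex)"
      by (simp add: matrix_matrix_mult_def matrix_vector_mult_def map_matrix_def)
    then show ?thesis by (simp add: c mat_def axis_def)
  qed
  then show ?thesis by (metis vec_eq_iff)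
qed

theorem theorem4p4:
  fixes A :: "int ^ 'n::{finite,linorder} ^ 'd::finite"
    and B :: "(complex ^ 'd) set"
    and D :: "complex ^ 'd \<Rightarrow> (complex ^ 'n::_) set"
    and F :: "complex ^ 'd \<Rightarrow> complex ^ 'n::_ \<Rightarrow> complex"
    and K :: "complex ^ 'd \<Rightarrow> complex"
    and T :: "complex ^ 'd ^ 'd"
    and P :: "complex ^ 'n::_ ^ 'n::_"
  assumes "surj (\<lambda>c :: int ^ 'n::_. A *v c)"
    and "\<exists>\<xi> :: nat ^ 'd. (\<chi> i. int (\<xi> $ i)) v* A = (\<chi> j. 1)"
    and "\<And>\<beta>. \<beta> \<in> B \<Longrightarrow> A_hypergeometric A \<beta> (D \<beta>) (F \<beta>)"
    and "permutation_matrix P"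
    and "generic (\<lambda>\<beta>. \<beta> \<in> B \<and> T *v \<beta> \<in> B \<and> hypergeometric_transformation D F K T P \<beta>)"
  shows "T ** map_matrix of_int A = map_matrix of_int A ** transpose P \<and>
    invertible T \<and> encodes_polytope_symmetry A (matrix_inv T) P"
proof -
  let ?A = "map_matrix of_int A :: complex ^ 'n::_ ^ 'd"
  obtain \<sigma> where \<sigma>: "\<sigma> permutes UNIV" and P: "P = (\<chi> i j. if i = \<sigma> j then 1 else 0)"
    using assms(4) unfolding permutation_matrix_def by blast
  define good where "good \<beta> \<longleftrightarrow>
      (\<beta> \<in> B \<and> T *v \<beta> \<in> B \<and> hypergeometric_transformation D F K T P \<beta>) \<and>
      (\<forall>l :: int ^ 'd. \<forall>m::int. l \<noteq> 0 \<longrightarrow> (\<Sum>i\<in>UNIV. of_int (l $ i) * \<beta> $ i) \<noteq> of_int m)" for \<beta>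
  have good: "generic good"
    unfolding good_def by (rule generic_conj[OF assms(5) generic_nonresonant])
  have branch: "\<exists>V f. open V \<and> separately_holomorphic f V \<and> (\<exists>x\<in>V. f x \<noteq> 0) \<and> solves_H A \<beta> V f \<and>
      (\<forall>i. \<forall>x\<in>V. (\<Sum>k\<in>UNIV. of_int (A $ i $ inv \<sigma> k) * x $ k * partial_deriv k f x) = (T *v \<beta>) $ i * f x)"
    if "good \<beta>" for \<beta>
  proof -
    have B: "\<beta> \<in> B" "T *v \<beta> \<in> B" and transf: "hypergeometric_transformation D F K T P \<beta>"
      using that[unfolded good_def, THEN conjunct1] by simp_all
    from transf obtain V where V: "open V" "V \<noteq> {}"
      and x: "\<And>x. x \<in> V \<Longrightarrow> x \<in> D \<beta> \<and> x v* P \<in> D (T *v \<beta>) \<and> F \<beta> x = K \<beta> * F (T *v \<beta>) (x v* P)"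
      unfolding hypergeometric_transformation_def by blast
    have f: "A_hypergeometric A \<beta> (D \<beta>) (F \<beta>)" and g: "A_hypergeometric A (T *v \<beta>) (D (T *v \<beta>)) (F (T *v \<beta>))"
      using B assms(3) by blast+
    have "V \<subseteq> D \<beta>" using x by blast
    moreover have "(\<Sum>k\<in>UNIV. of_int (A $ i $ inv \<sigma> k) * y $ k * partial_deriv k (F \<beta>) y) = (T *v \<beta>) $ i * F \<beta> y"
      if "y \<in> V" for i y
    proof (rule euler_transformed[OF \<sigma> P V(1) that])
      show "separately_holomorphic (F (T *v \<beta>)) (D (T *v \<beta>))" "solves_H A (T *v \<beta>) (D (T *v \<beta>)) (F (T *v \<beta>))"
        using g holomorphic_several_imp_separately_holomorphic unfolding A_hypergeometric_def by blast+
    qed (use x that in blast)+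
    ultimately show ?thesis
      using A_hypergeometric_local[OF f V] V by blast
  qed
  \<comment> \<open>The claim does not mention \<beta>, so one good parameter proves it for all
    rows.\<close>
  have "\<exists>N m. N > 0 \<and> (\<forall>k. N * A $ i $ inv \<sigma> k = (\<Sum>i'\<in>UNIV. m i' * A $ i' $ k))" for i
  proof -
    obtain \<beta> where "good \<beta>" using generic_ex[OF good] ..
    from branch[OF this]
    obtain V f where V: "open V" and f: "separately_holomorphic f V" "\<exists>x\<in>V. f x \<noteq> 0" "solves_H A \<beta> V f"
      and e: "\<forall>i. \<forall>x\<in>V. (\<Sum>k\<in>UNIV. of_int (A $ i $ inv \<sigma> k) * x $ k * partial_deriv k f x) = (T *v \<beta>) $ i * f x"
      by blast
    have "\<And>(l :: int ^ 'd) m :: int. l \<noteq> 0 \<Longrightarrow> (\<Sum>i\<in>UNIV. of_int (l $ i) * \<beta> $ i) \<noteq> of_int m"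
      using \<open>good \<beta>\<close>[unfolded good_def, THEN conjunct2] by blast
    from homogeneity_in_row_space[OF V f this, of "\<chi> k. A $ i $ inv \<sigma> k" "(T *v \<beta>) $ i"]
    show ?thesis using e[rule_format, of _ i] by simp
  qed
  then obtain N m where N: "\<And>i. N i > 0" and m: "\<And>i k. N i * A $ i $ inv \<sigma> k = (\<Sum>i'\<in>UNIV. m i i' * A $ i' $ k)"
    by metis
  define M :: "complex ^ 'd ^ 'd" where "M = (\<chi> i i'. of_int (m i i') / of_int (N i))"
  have M: "of_int (A $ i $ inv \<sigma> k) = (\<Sum>i'\<in>UNIV. M $ i $ i' * of_int (A $ i' $ k))" for i k
  proof -
    have "of_int (N i) * (of_int (A $ i $ inv \<sigma> k) :: complex) = (\<Sum>i'\<in>UNIV. of_int (m i i') * of_int (A $ i' $ k))"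
      using m[of i k] by (metis (no_types, lifting) of_int_mult of_int_sum sum.cong)
    then show ?thesis
      using N[of i] by (simp add: M_def field_simps flip: sum_divide_distrib)
  qed
  \<comment> \<open>Two degrees of the same nonzero function under the same Euler operator:
    \<open>T *v \<beta>\<close> from the transformation, \<open>M *v \<beta>\<close> from combining
    the equations of H_A(\<beta>) by the rows of \<open>M\<close>.\<close>
  have MT: "M *v \<beta> = T *v \<beta>" if "good \<beta>" for \<beta>
  proof -
    from branch[OF that] obtain V f where nz: "\<exists>x\<in>V. f x \<noteq> 0" and f: "solves_H A \<beta> V f"
      and e: "\<forall>i. \<forall>x\<in>V. (\<Sum>k\<in>UNIV. of_int (A $ i $ inv \<sigma> k) * x $ k * partial_deriv k f x) = (T *v \<beta>) $ i * f x"
      by blast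
    from nz obtain x where x: "x \<in> V" "f x \<noteq> 0" ..
    have "(T *v \<beta>) $ i * f x = (M *v \<beta>) $ i * f x" for i
    proof -
      have "(T *v \<beta>) $ i * f x
          = (\<Sum>k\<in>UNIV. \<Sum>i'\<in>UNIV. M $ i $ i' * (of_int (A $ i' $ k) * x $ k * partial_deriv k f x))"
        using e[rule_format, OF x(1), of i] by (simp add: M sum_distrib_right mult.assoc)
      also have "\<dots> = (\<Sum>i'\<in>UNIV. M $ i $ i' * (\<Sum>k\<in>UNIV. of_int (A $ i' $ k) * x $ k * partial_deriv k f x))"
        by (subst sum.swap) (simp add: sum_distrib_left)
      also have "\<dots> = (\<Sum>i'\<in>UNIV. M $ i $ i' * (\<beta> $ i' * f x))"
        by (simp add: solves_H_euler[OF f x(1)])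
      also have "\<dots> = (M *v \<beta>) $ i * f x"
        by (simp add: matrix_vector_mult_def sum_distrib_right mult.assoc)
      finally show ?thesis .
    qed
    then show ?thesis using x(2) by (simp add: vec_eq_iff)
  qed
  have "T $ i = M $ i" for i
  proof (rule ccontr)
    assume "T $ i \<noteq> M $ i"
    \<comment> \<open>A nonzero difference of rows is a linear form that is generically nonzero,
      hence nonzero at some good parameter, against \<open>MT\<close>.\<close>
    then have "generic (\<lambda>\<beta>. (\<Sum>j\<in>UNIV. (T $ i - M $ i) $ j * \<beta> $ j) \<noteq> 0)"
      by (intro generic_affine_nonzero) simp
    then obtain \<beta> where \<beta>: "good \<beta>" "(\<Sum>j\<in>UNIV. (T $ i - M $ i) $ j * \<beta> $ j) \<noteq> 0"
      using generic_ex[OF generic_conj[OF good]] by blast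
    then have "(T *v \<beta>) $ i \<noteq> (M *v \<beta>) $ i"
      by (simp add: matrix_vector_mult_def left_diff_distrib sum_subtractf)
    then show False using MT[OF \<beta>(1)] by simp
  qed
  then have "T = M" by (simp add: vec_eq_iff)
  have inv_eq: "k = \<sigma> j \<longleftrightarrow> j = inv \<sigma> k" for j k
    using permutes_inverses[OF \<sigma>] by metis
  have TA: "T ** ?A = ?A ** transpose P"
    unfolding \<open>T = M\<close>
    by (simp add: vec_eq_iff matrix_matrix_mult_def map_matrix_def transpose_def P M[symmetric] inv_eq if_distrib
        cong: if_cong)
  have PP: "transpose P ** P = mat 1"
  proof -
    have "(transpose P ** P) $ i $ j = (transpose P $ i v* P) $ j" for i j
      by (simp add: matrix_matrix_mult_def vector_matrix_mult_def mult.commute)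
    also have "(transpose P $ i v* P) $ j = mat 1 $ i $ j" for i j
      unfolding vector_matrix_mult_permutation[OF P] using permutes_inj[OF \<sigma>]
      by (auto simp: transpose_def P mat_def inj_eq)
    finally show ?thesis by (simp add: vec_eq_iff)
  qed
  \<comment> \<open>Multiplying \<open>TA\<close> by \<open>P\<close> on the right cancels the
    transpose; a right inverse of \<open>?A\<close> then yields one of the square matrix
    \<open>T\<close>.\<close>
  have TAP: "T ** (?A ** P) = ?A"
    by (metis TA PP matrix_mul_assoc matrix_mul_rid)
  obtain C :: "complex ^ 'd ^ 'n::_" where "?A ** C = mat 1"
    using surj_right_inverse[OF assms(1)] by blast
  then have "T ** (?A ** P ** C) = mat 1"
    using TAP by (simp add: matrix_mul_assoc)
  then have T: "invertible T"
    unfolding invertible_right_inverse by blast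
  have TT: "matrix_inv T ** T = mat 1"
    using T someI_ex[of "\<lambda>S. T ** S = mat 1 \<and> S ** T = mat 1"]
    unfolding invertible_def matrix_inv_def by blast
  have "matrix_inv T ** ?A = matrix_inv T ** (T ** (?A ** P))" by (simp add: TAP)
  also have "\<dots> = ?A ** P"
    by (simp add: matrix_mul_assoc TT)
  finally show ?thesis
    using TA T assms(4) by (simp add: encodes_polytope_symmetry_def)
qed

end
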